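(* Let $G$ be a connected graph of order $n$ and minimum degree $\delta$, and let $k$ be an integer with $\delta\geq k\geq 3$. If $G$ is isomorphic to a subgraph of $K_{k-1}\vee (K_{\delta-k+2}\cup K_{n-\delta-1})$ and $n\geq \frac{1}{2}(\delta-k+2)(k^2-2k+7)$, then $$\rho(G) < n-\delta+k-3,$$ unless $G\cong K_{k-1}\vee (K_{\delta-k+2}\cup K_{n-\delta-1})$.
   Context: All graphs are finite, simple and undirected. $\rho(G)$ denotes the spectral radius (largest eigenvalue) of the adjacency matrix of $G$. $K_r$ is the complete graph on $r$ vertices, $\cup$ is disjoint union and $G_1\vee G_2$ is the join (disjoint union plus all edges between $G_1$ and $G_2$). *)

theory Defs
  imports "Graph_Theory.Graph_Theory" "Jordan_Normal_Form.Spectral_Radius"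
begin

text \<open>
  Finite simple undirected graphs are elements of \<^typ>\<open>'a pair_pre_digraph\<close> satisfying
  \<^locale>\<open>pair_graph\<close>: finite, loop-free and symmetric, an undirected edge \<open>uv\<close> being the two
  arcs \<open>(u, v)\<close> and \<open>(v, u)\<close>. In particular \<^const>\<open>out_degree\<close> is the usual vertex degree.
\<close>

definition min_degree :: "'a pair_pre_digraph \<Rightarrow> nat" where
  "min_degree G = Min (out_degree (with_proj G) ` pverts G)"

definition graph_iso :: "'a pair_pre_digraph \<Rightarrow> 'b pair_pre_digraph \<Rightarrow> bool" where
  "graph_iso G H \<longleftrightarrow> digraph_iso (with_proj G) (with_proj H)"

definition iso_to_subgraph :: "'a pair_pre_digraph \<Rightarrow> 'b pair_pre_digraph \<Rightarrow> bool" where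
  "iso_to_subgraph G X \<longleftrightarrow>
     (\<exists>H :: 'b pair_pre_digraph. subgraph (with_proj H) (with_proj X) \<and> graph_iso G H)"

definition complete_graph :: "nat \<Rightarrow> nat pair_pre_digraph" where
  "complete_graph r = \<lparr> pverts = {..<r}, parcs = {(u, v). u < r \<and> v < r \<and> u \<noteq> v} \<rparr>"

definition disjoint_union ::
    "'a pair_pre_digraph \<Rightarrow> 'b pair_pre_digraph \<Rightarrow> ('a + 'b) pair_pre_digraph" where
  "disjoint_union G H =
     \<lparr> pverts = pverts G <+> pverts H,
       parcs = map_prod Inl Inl ` parcs G \<union> map_prod Inr Inr ` parcs H \<rparr>"

definition graph_join ::
    "'a pair_pre_digraph \<Rightarrow> 'b pair_pre_digraph \<Rightarrow> ('a + 'b) pair_pre_digraph" where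
  "graph_join G H =
     \<lparr> pverts = pverts (disjoint_union G H),
       parcs = parcs (disjoint_union G H)
         \<union> (Inl ` pverts G) \<times> (Inr ` pverts H) \<union> (Inr ` pverts H) \<times> (Inl ` pverts G) \<rparr>"

definition adjacency_mat :: "'a pair_pre_digraph \<Rightarrow> 'a list \<Rightarrow> complex mat" where
  "adjacency_mat G vs =
     mat (length vs) (length vs) (\<lambda>(i, j). if (vs ! i, vs ! j) \<in> parcs G then 1 else 0)"

text \<open>
  The choice of the vertex enumeration is immaterial, see \<open>graph_spectral_radius_eq\<close> below.
  \<^const>\<open>spectral_radius\<close> is the maximal modulus of an eigenvalue; for an adjacency matrix,
  which is symmetric with nonnegative entries, this is the largest eigenvalue.
\<close>
definition graph_spectral_radius :: "'a pair_pre_digraph \<Rightarrow> real" where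
  "graph_spectral_radius G =
     spectral_radius (adjacency_mat G (SOME vs. distinct vs \<and> set vs = pverts G))"

text \<open>\<open>K\<^bsub>k-1\<^esub> \<or> (K\<^bsub>\<delta>-k+2\<^esub> \<union> K\<^bsub>n-\<delta>-1\<^esub>)\<close>; the subtractions are not truncated when
  \<open>1 \<le> k \<le> \<delta> < n\<close>.\<close>
definition extremal_graph :: "nat \<Rightarrow> nat \<Rightarrow> nat \<Rightarrow> (nat + (nat + nat)) pair_pre_digraph" where
  "extremal_graph n \<delta> k =
     graph_join (complete_graph (k - 1))
       (disjoint_union (complete_graph (\<delta> - k + 2)) (complete_graph (n - \<delta> - 1)))"

lemma eigenvalue_adjacency_mat_reorder:
  assumes vs: "distinct vs" and ws: "distinct ws" and eq: "set vs = set ws"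
    and ev: "eigenvalue (adjacency_mat G vs) k"
  shows "eigenvalue (adjacency_mat G ws) k"
proof -
  define n where "n = length vs"
  have len: "length ws = n"
    using distinct_card[OF vs] distinct_card[OF ws] eq unfolding n_def by simp
  have "\<exists>j<n. vs ! j = ws ! i" if "i < n" for i
  proof -
    have "ws ! i \<in> set vs"
      using that eq len by simp
    then show ?thesis
      unfolding n_def in_set_conv_nth .
  qed
  then have "\<exists>p. \<forall>i. i < n \<longrightarrow> p i < n \<and> vs ! p i = ws ! i"
    by (intro choice) blast
  then obtain p where p: "\<And>i. i < n \<Longrightarrow> p i < n \<and> vs ! p i = ws ! i"
    by blast
  have inj: "inj_on p {..<n}"
  proof (rule inj_onI)
    fix i j assume "i \<in> {..<n}" "j \<in> {..<n}" "p i = p j"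
    then have "ws ! i = ws ! j" "i < length ws" "j < length ws"
      using p[of i] p[of j] len by simp_all
    then show "i = j"
      using ws by (simp add: nth_eq_iff_index_eq)
  qed
  have "p ` {..<n} \<subseteq> {..<n}"
    using p by auto
  then have bij: "bij_betw p {..<n} {..<n}"
    using inj by (simp add: bij_betw_def endo_inj_surj)
  from ev obtain x where x: "x \<in> carrier_vec n" "x \<noteq> 0\<^sub>v n"
      "adjacency_mat G vs *\<^sub>v x = k \<cdot>\<^sub>v x"
    unfolding eigenvalue_def eigenvector_def by (auto simp: adjacency_mat_def n_def)
  have row: "(\<Sum>j<n. (if (vs ! i, vs ! j) \<in> parcs G then 1 else 0) * x $ j) = k * x $ i"
    if "i < n" for i
  proof -
    have "(adjacency_mat G vs *\<^sub>v x) $ i = (k \<cdot>\<^sub>v x) $ i"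
      using x by simp
    then show ?thesis
      using that x(1) unfolding adjacency_mat_def n_def
      by (simp add: scalar_prod_def atLeast0LessThan)
  qed
  define y where "y = vec n (\<lambda>i. x $ p i)"
  have "y \<noteq> 0\<^sub>v n"
  proof
    assume y0: "y = 0\<^sub>v n"
    have "x $ j = 0" if "j < n" for j
    proof -
      have "j \<in> p ` {..<n}"
        using that bij by (simp add: bij_betw_def)
      then obtain i where i: "i < n" "p i = j"
        by blast
      then have "x $ j = y $ i"
        by (simp add: y_def)
      then show ?thesis
        using y0 i by simp
    qed
    then have "x = 0\<^sub>v n"
      using x(1) by (intro eq_vecI) auto
    with x show False
      by simp
  qed
  moreover have "adjacency_mat G ws *\<^sub>v y = k \<cdot>\<^sub>v y"
  proof (rule eq_vecI)
    show "dim_vec (adjacency_mat G ws *\<^sub>v y) = dim_vec (k \<cdot>\<^sub>v y)"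
      by (simp add: adjacency_mat_def y_def len)
    fix i assume "i < dim_vec (k \<cdot>\<^sub>v y)"
    then have i: "i < n"
      by (simp add: y_def)
    have "(adjacency_mat G ws *\<^sub>v y) $ i
        = (\<Sum>j<n. (if (ws ! i, ws ! j) \<in> parcs G then 1 else 0) * x $ p j)"
      using i len unfolding adjacency_mat_def y_def
      by (simp add: scalar_prod_def atLeast0LessThan)
    also have "\<dots> = (\<Sum>j<n. (if (vs ! p i, vs ! p j) \<in> parcs G then 1 else 0) * x $ p j)"
      using p i by (intro sum.cong) auto
    also have "\<dots> = (\<Sum>j<n. (if (vs ! p i, vs ! j) \<in> parcs G then 1 else 0) * x $ j)"
      by (rule sum.reindex_bij_betw[OF bij])
    also have "\<dots> = k * x $ p i"
      using p i by (intro row) auto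
    also have "\<dots> = (k \<cdot>\<^sub>v y) $ i"
      using i by (simp add: y_def)
    finally show "(adjacency_mat G ws *\<^sub>v y) $ i = (k \<cdot>\<^sub>v y) $ i" .
  qed
  moreover have "dim_row (adjacency_mat G ws) = n" "y \<in> carrier_vec n"
    by (simp_all add: adjacency_mat_def y_def len)
  ultimately have "eigenvector (adjacency_mat G ws) y k"
    by (simp only: eigenvector_def not_False_eq_True simp_thms)
  then show ?thesis
    unfolding eigenvalue_def by (rule exI)
qed

lemma graph_spectral_radius_eq:
  assumes "distinct vs" and "set vs = pverts G"
  shows "graph_spectral_radius G = spectral_radius (adjacency_mat G vs)"
proof -
  define ws where "ws = (SOME vs. distinct vs \<and> set vs = pverts G)"
  have ws: "distinct ws \<and> set ws = pverts G"
    unfolding ws_def by (rule someI[of _ vs]) (simp add: assms)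
  have "spectrum (adjacency_mat G ws) = spectrum (adjacency_mat G vs)"
    unfolding spectrum_def using assms ws
    by (intro Collect_cong iffI) (erule eigenvalue_adjacency_mat_reorder[rotated 3]; simp)+
  then show ?thesis
    unfolding graph_spectral_radius_def spectral_radius_def ws_def by simp
qed

lemma pair_graphI:
  assumes fin: "finite (pverts G)"
    and arc: "\<And>u v. (u, v) \<in> parcs G \<Longrightarrow>
      u \<in> pverts G \<and> v \<in> pverts G \<and> u \<noteq> v \<and> (v, u) \<in> parcs G"
  shows "pair_graph G"
proof -
  have "parcs G \<subseteq> pverts G \<times> pverts G"
    using arc by auto
  then have "finite (parcs G)"
    using fin by (meson finite_SigmaI finite_subset)
  moreover have "symmetric (with_proj G)"
    using arc by (auto simp: symmetric_def sym_def)
  ultimately show ?thesis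
    using fin arc by unfold_locales (auto dest: arc)
qed

lemma pair_graph_arcD:
  assumes "pair_graph G" "(u, v) \<in> parcs G"
  shows "u \<in> pverts G" "v \<in> pverts G" "u \<noteq> v" "(v, u) \<in> parcs G"
proof -
  interpret pair_graph G by fact
  show "u \<in> pverts G" "v \<in> pverts G"
    using assms(2) by (auto dest: wellformed')
  show "u \<noteq> v"
    using pair_no_loops[OF assms(2)] by simp
  show "(v, u) \<in> parcs G"
    using arcs_ends_symmetric[OF pair_sym_arcs] assms(2) by simp
qed

lemma pair_graph_complete_graph: "pair_graph (complete_graph r)"
  by (rule pair_graphI) (auto simp: complete_graph_def)

lemma complete_digraph_complete_graph: "complete_digraph r (with_proj (complete_graph r))"
  unfolding complete_digraph_pair_def by (auto simp: complete_graph_def)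

lemma disjoint_union_simps [simp]:
  "Inl u \<in> pverts (disjoint_union G H) \<longleftrightarrow> u \<in> pverts G"
  "Inr x \<in> pverts (disjoint_union G H) \<longleftrightarrow> x \<in> pverts H"
  "(Inl u, Inl v) \<in> parcs (disjoint_union G H) \<longleftrightarrow> (u, v) \<in> parcs G"
  "(Inr x, Inr y) \<in> parcs (disjoint_union G H) \<longleftrightarrow> (x, y) \<in> parcs H"
  "(Inl u, Inr x) \<notin> parcs (disjoint_union G H)"
  "(Inr x, Inl u) \<notin> parcs (disjoint_union G H)"
  by (force simp: disjoint_union_def)+

lemma graph_join_simps [simp]:
  "Inl u \<in> pverts (graph_join G H) \<longleftrightarrow> u \<in> pverts G"
  "Inr x \<in> pverts (graph_join G H) \<longleftrightarrow> x \<in> pverts H"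
  "(Inl u, Inl v) \<in> parcs (graph_join G H) \<longleftrightarrow> (u, v) \<in> parcs G"
  "(Inr x, Inr y) \<in> parcs (graph_join G H) \<longleftrightarrow> (x, y) \<in> parcs H"
  "(Inl u, Inr x) \<in> parcs (graph_join G H) \<longleftrightarrow> u \<in> pverts G \<and> x \<in> pverts H"
  "(Inr x, Inl u) \<in> parcs (graph_join G H) \<longleftrightarrow> u \<in> pverts G \<and> x \<in> pverts H"
  by (auto simp: graph_join_def)

lemma pair_graph_disjoint_union:
  assumes "pair_graph G" "pair_graph H"
  shows "pair_graph (disjoint_union G H)"
proof (rule pair_graphI)
  interpret G: pair_graph G by fact
  interpret H: pair_graph H by fact
  show "finite (pverts (disjoint_union G H))"
    by (simp add: disjoint_union_def G.pair_finite_verts H.pair_finite_verts)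
  fix u v assume "(u, v) \<in> parcs (disjoint_union G H)"
  then show "u \<in> pverts (disjoint_union G H) \<and> v \<in> pverts (disjoint_union G H) \<and> u \<noteq> v
      \<and> (v, u) \<in> parcs (disjoint_union G H)"
    by (cases u; cases v) (auto dest: assms[THEN pair_graph_arcD(1)]
        assms[THEN pair_graph_arcD(2)] assms[THEN pair_graph_arcD(3)]
        assms[THEN pair_graph_arcD(4)])
qed

lemma pair_graph_graph_join:
  assumes "pair_graph G" "pair_graph H"
  shows "pair_graph (graph_join G H)"
proof (rule pair_graphI)
  interpret G: pair_graph G by fact
  interpret H: pair_graph H by fact
  show "finite (pverts (graph_join G H))"
    by (simp add: graph_join_def disjoint_union_def G.pair_finite_verts H.pair_finite_verts)
  fix u v assume "(u, v) \<in> parcs (graph_join G H)"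
  then show "u \<in> pverts (graph_join G H) \<and> v \<in> pverts (graph_join G H) \<and> u \<noteq> v
      \<and> (v, u) \<in> parcs (graph_join G H)"
    by (cases u; cases v) (auto dest: assms[THEN pair_graph_arcD(1)]
        assms[THEN pair_graph_arcD(2)] assms[THEN pair_graph_arcD(3)]
        assms[THEN pair_graph_arcD(4)])
qed

lemma card_pverts_extremal_graph:
  assumes "1 \<le> k" "k \<le> \<delta>" "\<delta> < n"
  shows "card (pverts (extremal_graph n \<delta> k)) = n"
proof -
  have "card (pverts (extremal_graph n \<delta> k)) = (k - 1) + ((\<delta> - k + 2) + (n - \<delta> - 1))"
    unfolding extremal_graph_def graph_join_def disjoint_union_def complete_graph_def
    by (simp add: card_Plus)
  then show ?thesis
    using assms by simp
qed

end

theory Submission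
  imports Defs
begin

text \<open>
  Write \<open>A\<close>, \<open>B\<close>, \<open>C\<close> for the three cliques, of orders \<open>a = k - 1\<close>, \<open>b = \<delta> - k + 2\<close> and
  \<open>c = n - \<delta> - 1\<close>. The vertices of \<open>B\<close> have degree exactly \<open>\<delta>\<close> in the extremal graph, so \<open>G\<close>
  keeps all their edges and must miss an edge \<open>e\<close> inside \<open>A \<union> C\<close>. Put \<open>m = a + c\<close>, so that the
  bound to be shown is \<open>m - 1\<close>. By the Collatz--Wielandt bound it suffices to find a positive
  weight \<open>w\<close> whose sum over the neighbours of each vertex \<open>x\<close> is less than \<open>(m - 1) w(x)\<close>. Such a
  weight is \<open>q\<close> on \<open>B\<close> and \<open>1 + (b q / m) [x \<in> A] - [x \<in> e] / (m + 1)\<close> on \<open>A \<union> C\<close>, with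
  \<open>q = (a + 2 / (m + 1)) / (m - b)\<close>; the lower bound on \<open>n\<close> amounts to \<open>b (a\<^sup>2 + 4) \<le> 2 m\<close>,
  which implies the needed inequality \<open>a b q / m < 2 / (m + 1)\<close>.
\<close>

section \<open>Weighted row sum bounds for the spectral radius\<close>

text \<open>Take an eigenvector \<open>x\<close> for an eigenvalue of maximal modulus and an index
  \<open>i\<close> maximising \<open>norm (x $ i) / w i\<close>. The triangle inequality in row
  \<open>i\<close> of the eigenvalue equation gives the bound.\<close>

lemma spectral_radius_lt_weighted_row_sum:
  fixes M :: "complex mat" and w :: "nat \<Rightarrow> real"
  assumes M: "M \<in> carrier_mat n n" and n: "n > 0"
    and pos: "\<And>i. i < n \<Longrightarrow> 0 < w i"
    and row: "\<And>i. i < n \<Longrightarrow> (\<Sum>j<n. norm (M $$ (i, j)) * w j) < r * w i"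
  shows "spectral_radius M < r"
proof -
  obtain \<mu> where \<mu>: "eigenvalue M \<mu>" "spectral_radius M = norm \<mu>"
    using spectral_radius_mem_max(1)[OF M n] by (auto simp: spectrum_def)
  from \<mu>(1) obtain x where x: "x \<in> carrier_vec n" "x \<noteq> 0\<^sub>v n" "M *\<^sub>v x = \<mu> \<cdot>\<^sub>v x"
    using M unfolding eigenvalue_def eigenvector_def by auto
  define R where "R = Max ((\<lambda>i. norm (x $ i) / w i) ` {..<n})"
  have "R \<in> (\<lambda>i. norm (x $ i) / w i) ` {..<n}"
    unfolding R_def using n by (intro Max_in) auto
  then obtain i where i: "i < n" and Ri: "R = norm (x $ i) / w i"
    by auto
  have le_R: "norm (x $ j) \<le> R * w j" if "j < n" for j
  proof -
    have "norm (x $ j) / w j \<le> R"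
      unfolding R_def using that by (intro Max_ge) auto
    then show ?thesis
      using pos[OF that] by (simp add: divide_le_eq)
  qed
  \<comment> \<open>Positivity of \<open>R\<close> keeps the row inequality strict after scaling by
    \<open>R\<close>.\<close>
  have R_pos: "R > 0"
  proof (rule ccontr)
    assume "\<not> R > 0"
    then have "x $ j = 0" if "j < n" for j
      using le_R[OF that] pos[OF that] mult_nonpos_nonneg[of R "w j"] norm_ge_zero[of "x $ j"]
      by (smt (verit) norm_eq_zero)
    then have "x = 0\<^sub>v n"
      using x(1) by (intro eq_vecI) auto
    with x(2) show False ..
  qed
  have "\<mu> * x $ i = (M *\<^sub>v x) $ i"
    using x i by simp
  also have "\<dots> = (\<Sum>j<n. M $$ (i, j) * x $ j)"
    using M x(1) i by (simp add: scalar_prod_def atLeast0LessThan)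
  finally have "norm \<mu> * norm (x $ i) = norm (\<Sum>j<n. M $$ (i, j) * x $ j)"
    by (metis norm_mult)
  also have "\<dots> \<le> (\<Sum>j<n. norm (M $$ (i, j)) * norm (x $ j))"
    by (rule order_trans[OF norm_sum]) (simp add: norm_mult)
  also have "\<dots> \<le> (\<Sum>j<n. norm (M $$ (i, j)) * (R * w j))"
    using le_R by (intro sum_mono mult_left_mono) auto
  also have "\<dots> = R * (\<Sum>j<n. norm (M $$ (i, j)) * w j)"
    by (simp add: sum_distrib_left mult_ac)
  also have "\<dots> < R * (r * w i)"
    using row[OF i] R_pos by simp
  also have "\<dots> = r * norm (x $ i)"
    using Ri pos[OF i] by simp
  finally have "norm \<mu> * norm (x $ i) < r * norm (x $ i)" .
  then have "norm \<mu> < r"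
    by (simp add: mult_less_cancel_right)
  then show ?thesis
    using \<mu>(2) by simp
qed

lemma graph_spectral_radius_lt_weighted_neighbour_sum:
  assumes G: "pair_graph G" and ne: "pverts G \<noteq> {}"
    and pos: "\<And>x. x \<in> pverts G \<Longrightarrow> 0 < w x"
    and nbr: "\<And>x. x \<in> pverts G \<Longrightarrow> (\<Sum>y | (x, y) \<in> parcs G. w y) < r * w x"
  shows "graph_spectral_radius G < r"
proof -
  interpret pair_graph G by fact
  obtain vs where vs: "set vs = pverts G" "distinct vs"
    using finite_distinct_list[OF pair_finite_verts] by blast
  define n where "n = length vs"
  have n: "n > 0"
    using vs(1) ne unfolding n_def by auto
  have in_V: "vs ! i \<in> pverts G" if "i < n" for i
    using that vs(1) unfolding n_def by (metis nth_mem)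
  have bij: "bij_betw ((!) vs) {..<n} (pverts G)"
    using bij_betw_nth[OF vs(2)] vs(1) unfolding n_def by simp
  have "spectral_radius (adjacency_mat G vs) < r"
  proof (rule spectral_radius_lt_weighted_row_sum[where w = "\<lambda>i. w (vs ! i)" and n = n])
    show "adjacency_mat G vs \<in> carrier_mat n n"
      by (simp add: adjacency_mat_def n_def)
    show "n > 0" by fact
    fix i assume i: "i < n"
    show "0 < w (vs ! i)"
      using pos in_V[OF i] .
    have "(\<Sum>j<n. norm (adjacency_mat G vs $$ (i, j)) * w (vs ! j))
        = (\<Sum>j<n. if (vs ! i, vs ! j) \<in> parcs G then w (vs ! j) else 0)"
      using i by (intro sum.cong) (auto simp: adjacency_mat_def n_def)
    also have "\<dots> = (\<Sum>y\<in>pverts G. if (vs ! i, y) \<in> parcs G then w y else 0)"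
      by (rule sum.reindex_bij_betw[OF bij])
    also have "\<dots> = (\<Sum>y\<in>{y \<in> pverts G. (vs ! i, y) \<in> parcs G}. w y)"
      by (rule sum.inter_filter[symmetric]) (rule pair_finite_verts)
    also have "{y \<in> pverts G. (vs ! i, y) \<in> parcs G} = {y. (vs ! i, y) \<in> parcs G}"
      using pair_graph_arcD(2)[OF G] by blast
    also have "(\<Sum>y\<in>{y. (vs ! i, y) \<in> parcs G}. w y) < r * w (vs ! i)"
      using nbr in_V[OF i] .
    finally show "(\<Sum>j<n. norm (adjacency_mat G vs $$ (i, j)) * w (vs ! j)) < r * w (vs ! i)" .
  qed
  then show ?thesis
    using graph_spectral_radius_eq[OF vs(2,1)] by simp
qed

section \<open>The weight for a graph with a missing edge\<close>

text \<open>Compares the total bonus on \<open>A\<close> with the total deduction at the ends of the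
  missing edge. Clearing denominators leaves
  \<open>a * b * (a * (m + 1) + 2) < 2 * (m - b) * m\<close>, which follows from \<open>am\<close>
  and \<open>mb\<close>.\<close>

lemma weight_excess_bound:
  fixes a b m :: real
  assumes a: "0 \<le> a" and b: "2 \<le> b" and m: "b * (a\<^sup>2 + 4) \<le> 2 * m"
  shows "a * (b * ((a + 2 / (m + 1)) / (m - b))) / m < 2 / (m + 1)"
proof -
  have b_sq: "2 * a\<^sup>2 \<le> b * a\<^sup>2"
    using b by (intro mult_right_mono) auto
  have mb: "b * (a\<^sup>2 + 2) \<le> 2 * (m - b)"
    using m by (simp add: algebra_simps)
  have "b * 4 \<le> b * (a\<^sup>2 + 4)"
    using b by (intro mult_left_mono) auto
  then have "0 < m - b" "0 < m"
    using m b by linarith+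
  \<comment> \<open>This gives \<open>2 * a \<le> a\<^sup>2 + 1\<close>, hence \<open>a\<^sup>2 + 2
    * a < 2 * a\<^sup>2 + 8 \<le> b * (a\<^sup>2 + 4) \<le> 2 * m\<close>.\<close>
  have "0 \<le> (a - 1)\<^sup>2" by simp
  then have am: "a\<^sup>2 + 2 * a < 2 * m"
    using m b b_sq by (simp add: algebra_simps power2_eq_square)
  have "a * b * (a * (m + 1) + 2) = b * (a\<^sup>2 * m + (a\<^sup>2 + 2 * a))"
    by (simp add: algebra_simps power2_eq_square)
  also have "\<dots> < b * (a\<^sup>2 * m + 2 * m)"
    using am b by simp
  also have "\<dots> = b * (a\<^sup>2 + 2) * m"
    by (simp add: algebra_simps)
  also have "\<dots> \<le> 2 * (m - b) * m"
    using mb \<open>0 < m\<close> by (intro mult_right_mono) auto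
  finally have "a * b * (a * (m + 1) + 2) < 2 * (m - b) * m" .
  moreover have "a * (b * ((a + 2 / (m + 1)) / (m - b))) / m
      = (a * b * (a * (m + 1) + 2)) / ((m + 1) * ((m - b) * m))"
    using \<open>0 < m\<close> \<open>0 < m - b\<close> by (simp add: divide_simps)
  moreover have "2 / (m + 1) = (2 * (m - b) * m) / ((m + 1) * ((m - b) * m))"
    using \<open>0 < m\<close> \<open>0 < m - b\<close> by (simp add: divide_simps)
  moreover have "0 < (m + 1) * ((m - b) * m)"
    using \<open>0 < m\<close> \<open>0 < m - b\<close> by simp
  ultimately show ?thesis
    using divide_strict_right_mono by metis
qed

text \<open>All neighbour sums are estimated from above, so only absent edges matter: those between
  \<open>B\<close> and \<open>C\<close>, and \<open>uv\<close>.\<close>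

lemma graph_spectral_radius_lt_of_missing_edge:
  fixes A B C :: "'a set"
  defines "a \<equiv> real (card A)" and "b \<equiv> real (card B)" and "m \<equiv> real (card (A \<union> C))"
  assumes G: "pair_graph G"
    and V: "pverts G = A \<union> B \<union> C"
    and AB: "A \<inter> B = {}" and BC: "B \<inter> C = {}"
    and no_BC: "\<And>x y. x \<in> B \<Longrightarrow> y \<in> C \<Longrightarrow> (x, y) \<notin> parcs G"
    and e: "u \<in> A \<union> C" "v \<in> A \<union> C" "u \<noteq> v" "(u, v) \<notin> parcs G"
    and b: "2 \<le> b" and m: "b * (a\<^sup>2 + 4) \<le> 2 * m"
  shows "graph_spectral_radius G < m - 1"
proof -
  interpret pair_graph G by fact
  have fin: "finite A" "finite B" "finite C"
    using pair_finite_verts V by simp_all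
  have vu: "(v, u) \<notin> parcs G"
    using e(4) pair_graph_arcD(4)[OF G] by blast
  define q where "q = (a + 2 / (m + 1)) / (m - b)"
  define \<beta> where "\<beta> = b * q"
  \<comment> \<open>The bonus \<open>\<beta> / m\<close>, multiplied by \<open>m\<close>, pays a
    vertex of \<open>A\<close> for the total weight \<beta> of \<open>B\<close>. The deduction t = 1
    / (m + 1) solves 1 - t = m t, which balances the two ends of the missing edge. The value of
    \<open>q\<close> makes \<open>(m - b) * q\<close> the bound for \<open>sum w A\<close>.\<close>
  define w where "w x = (if x \<in> B then q
    else 1 + (if x \<in> A then \<beta> / m else 0) - (if x \<in> {u, v} then 1 / (m + 1) else 0))" for x
  have a: "0 \<le> a"
    by (simp add: a_def)
  have excess: "a * (\<beta> / m) < 2 / (m + 1)"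
    using weight_excess_bound[OF a b m] by (simp add: \<beta>_def q_def)
  have "b * 4 \<le> b * (a\<^sup>2 + 4)"
    using b by (intro mult_left_mono) auto
  then have m_pos: "0 < m" and mb: "0 < m - b"
    using m b by linarith+
  have q: "0 < q"
    unfolding q_def using a m_pos mb by (intro divide_pos_pos add_nonneg_pos) auto
  have \<beta>: "0 < \<beta>"
    using q b by (simp add: \<beta>_def)
  have w_AC: "w x = 1 + (if x \<in> A then \<beta> / m else 0) - (if x \<in> {u, v} then 1 / (m + 1) else 0)"
    if "x \<in> A \<union> C" for x
    using that AB BC by (auto simp: w_def)
  have w_pos: "0 < w x" for x
  proof -
    have "1 / (m + 1) < 1" "0 < \<beta> / m"
      using m_pos \<beta> by simp_all
    then show ?thesis
      using q by (auto simp: w_def)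
  qed
  have "sum w (A \<union> C) = (\<Sum>x\<in>A \<union> C.
      1 + (if x \<in> A then \<beta> / m else 0) - (if x \<in> {u, v} then 1 / (m + 1) else 0))"
    by (rule sum.cong) (use w_AC in auto)
  also have "\<dots> = m + (\<Sum>x\<in>(A \<union> C) \<inter> A. \<beta> / m) - (\<Sum>x\<in>(A \<union> C) \<inter> {u, v}. 1 / (m + 1))"
    using fin by (subst (1 2) sum.inter_restrict) (auto simp: sum.distrib sum_subtractf m_def)
  also have "(A \<union> C) \<inter> A = A"
    by blast
  also have "(A \<union> C) \<inter> {u, v} = {u, v}"
    using e by blast
  finally have S: "sum w (A \<union> C) = m + a * (\<beta> / m) - 2 / (m + 1)"
    using e(3) by (simp add: a_def)
  have S_lt: "sum w (A \<union> C) < m"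
    using S excess by simp
  have S_B: "sum w B = \<beta>"
    by (simp add: w_def \<beta>_def b_def)
  \<comment> \<open>Deductions are dropped here, since \<open>u\<close> and \<open>v\<close> may lie
    outside \<open>A\<close>.\<close>
  have "sum w A \<le> (\<Sum>x\<in>A. 1 + \<beta> / m)"
    using m_pos w_AC by (intro sum_mono) auto
  then have S_A: "sum w A < a + 2 / (m + 1)"
    using excess by (simp add: a_def distrib_left)
  show ?thesis
  proof (rule graph_spectral_radius_lt_weighted_neighbour_sum[where w = w, OF G])
    show "pverts G \<noteq> {}"
      using V e(1) by auto
    show "0 < w x" for x
      by (rule w_pos)
    fix x assume x: "x \<in> pverts G"
    have sum_le: "(\<Sum>y | (x, y) \<in> parcs G. w y) \<le> sum w (T - E)"
      if "finite T" "{y. (x, y) \<in> parcs G} \<subseteq> T - E" for T E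
      using that w_pos by (intro sum_mono2) (auto intro: less_imp_le)
    have nbr: "{y. (x, y) \<in> parcs G} \<subseteq> A \<union> B \<union> C - {x}"
      using V pair_graph_arcD(2,3)[OF G, of x] by auto
    show "(\<Sum>y | (x, y) \<in> parcs G. w y) < (m - 1) * w x"
    proof (cases "x \<in> B")
      case True
      then have "{y. (x, y) \<in> parcs G} \<subseteq> (A \<union> B) - {x}"
        using nbr no_BC by blast
      with fin have "(\<Sum>y | (x, y) \<in> parcs G. w y) \<le> sum w (A \<union> B - {x})"
        by (intro sum_le) auto
      also have "\<dots> = sum w A + \<beta> - w x"
        using True fin AB S_B by (simp add: sum_diff1 sum.union_disjoint)
      also have "\<dots> < (m - b) * q + b * q - w x"
        using S_A mb by (simp add: q_def \<beta>_def)
      also have "\<dots> = (m - 1) * w x"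
        using True by (simp add: w_def algebra_simps)
      finally show ?thesis .
    next
      case False
      then have x_AC: "x \<in> A \<union> C"
        using x V by blast
      \<comment> \<open>\<open>T\<close> contains the closed neighbourhood of \<open>x\<close>; only
        vertices of \<open>A\<close> can see both \<open>B\<close> and \<open>C\<close>.\<close>
      define T where "T = A \<union> C \<union> (if x \<in> A then B else {})"
      have nbr_T: "{y. (x, y) \<in> parcs G} \<subseteq> T - {x}"
        using nbr no_BC x_AC pair_graph_arcD(4)[OF G, of x] by (auto simp: T_def)
      have "finite T"
        using fin by (simp add: T_def)
      have "sum w T = sum w (A \<union> C) + (if x \<in> A then \<beta> else 0)"
      proof (cases "x \<in> A")
        case True
        then have "sum w T = sum w (A \<union> C) + sum w B"
          using fin AB BC unfolding T_def by (simp only: if_True) (rule sum.union_disjoint, auto)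
        with True S_B show ?thesis
          by simp
      qed (simp add: T_def)
      then have S_T: "sum w T < m + (if x \<in> A then \<beta> else 0)"
        using S_lt by simp
      show ?thesis
      proof (cases "x \<in> {u, v}")
        case True
        then obtain z where z: "{x, z} = {u, v}" "x \<noteq> z"
          using e(3) by blast
        then have "(x, z) \<notin> parcs G" and z_AC: "z \<in> A \<union> C"
          using e vu by (auto simp: doubleton_eq_iff)
        then have "{y. (x, y) \<in> parcs G} \<subseteq> T - {x, z}"
          using nbr_T by blast
        with \<open>finite T\<close> have "(\<Sum>y | (x, y) \<in> parcs G. w y) \<le> sum w (T - {x, z})"
          by (rule sum_le)
        also have "\<dots> = sum w T - (w x + w z)"
          using x_AC z_AC z(2) \<open>finite T\<close> by (subst sum_diff) (auto simp: T_def)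
        also have "\<dots> < m + (if x \<in> A then \<beta> else 0) - (w x + w z)"
          using S_T by simp
        \<comment> \<open>An end of the missing edge also loses the weight of the other end
          \<open>z\<close>. As \<open>w z\<close> is at least \<open>m / (m + 1)\<close>, this
          covers the \<open>m / (m + 1)\<close> by which the deduction lowers
          \<open>m * w x\<close>.\<close>
        also have "\<dots> \<le> (m - 1) * w x"
        proof -
          have "z \<in> {u, v}"
            using z by blast
          have wx: "w x = 1 + (if x \<in> A then \<beta> / m else 0) - 1 / (m + 1)"
            using w_AC[OF x_AC] True by simp
          have "m * w x = m + (if x \<in> A then \<beta> else 0) - m / (m + 1)"
            unfolding wx using m_pos by (simp add: algebra_simps)
          moreover have "m / (m + 1) = 1 - 1 / (m + 1)"
            using m_pos by (simp add: field_simps)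
          then have "w z \<ge> m / (m + 1)"
            using w_AC[OF z_AC] \<open>z \<in> {u, v}\<close> m_pos \<beta> by simp
          ultimately show ?thesis
            by (simp add: left_diff_distrib)
        qed
        finally show ?thesis .
      next
        case False
        have "(\<Sum>y | (x, y) \<in> parcs G. w y) \<le> sum w (T - {x})"
          using \<open>finite T\<close> nbr_T by (rule sum_le)
        also have "\<dots> = sum w T - w x"
          using x_AC \<open>finite T\<close> by (simp add: sum_diff1 T_def)
        also have "\<dots> < m + (if x \<in> A then \<beta> else 0) - w x"
          using S_T by simp
        also have "\<dots> = (m - 1) * w x"
          using w_AC[OF x_AC] False m_pos by (simp add: algebra_simps)
        finally show ?thesis .
      qed
    qed
  qed
qed

section \<open>Isomorphisms as vertex maps, and degrees as neighbour counts\<close>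

text \<open>An isomorphism carries a separate arc map. Since tails and heads are \<open>fst\<close>
  and \<open>snd\<close> on both sides, the vertex map determines it on the arcs.\<close>

lemma graph_isoE:
  assumes "graph_iso G H"
  obtains f where "inj_on f (pverts G)" "pverts H = f ` pverts G"
    "parcs H = map_prod f f ` parcs G"
proof -
  obtain h where h: "pre_digraph.digraph_isomorphism (with_proj G) h"
      "with_proj H = app_iso h (with_proj G)"
    using assms unfolding graph_iso_def digraph_iso_def by blast
  have H: "pverts H = iso_verts h ` pverts G" "parcs H = iso_arcs h ` parcs G"
      "iso_tail h = fst" "iso_head h = snd"
    using arg_cong[OF h(2), of verts] arg_cong[OF h(2), of arcs]
      arg_cong[OF h(2), of tail] arg_cong[OF h(2), of head] by simp_all
  have "iso_arcs h x = map_prod (iso_verts h) (iso_verts h) x" if "x \<in> parcs G" for x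
    using h(1) that H(3,4) unfolding pre_digraph.digraph_isomorphism_def
    by (simp add: prod_eq_iff)
  then have "parcs H = map_prod (iso_verts h) (iso_verts h) ` parcs G"
    using H(2) by (simp cong: image_cong)
  moreover have "inj_on (iso_verts h) (pverts G)"
    using h(1) by (simp add: pre_digraph.digraph_isomorphism_def)
  ultimately show thesis
    using H(1) that by blast
qed

lemma graph_isoI:
  assumes G: "pair_graph G" and inj: "inj_on f (pverts G)" and V: "pverts H = f ` pverts G"
    and E: "parcs H = map_prod f f ` parcs G"
  shows "graph_iso G H"
proof -
  interpret pair_graph G by fact
  let ?h = "\<lparr> iso_verts = f, iso_arcs = map_prod f f, iso_head = snd, iso_tail = fst \<rparr>"
  have "inj_on (map_prod f f) (pverts G \<times> pverts G)"
    using inj by (simp add: map_prod_inj_on)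
  then have "inj_on (map_prod f f) (parcs G)"
    by (rule inj_on_subset) (use pair_graph_arcD(1,2)[OF G] in auto)
  then have "pre_digraph.digraph_isomorphism (with_proj G) ?h"
    using inj wf_digraph_axioms by (simp add: pre_digraph.digraph_isomorphism_def)
  moreover have "with_proj H = app_iso ?h (with_proj G)"
    using V E by (simp add: with_proj_def app_iso_def)
  ultimately show ?thesis
    unfolding graph_iso_def digraph_iso_def by blast
qed

lemma min_degree_le_card_neighbours:
  assumes G: "pair_graph G" and x: "x \<in> pverts G"
  shows "min_degree G \<le> card {y. (x, y) \<in> parcs G}"
proof -
  interpret pair_graph G by fact
  have "min_degree G \<le> out_degree (with_proj G) x"
    unfolding min_degree_def using x pair_finite_verts by (intro Min_le) auto
  also have "out_arcs (with_proj G) x = Pair x ` {y. (x, y) \<in> parcs G}"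
    by (auto simp: out_arcs_def)
  then have "out_degree (with_proj G) x = card {y. (x, y) \<in> parcs G}"
    by (simp add: out_degree_def card_image inj_on_def)
  finally show ?thesis .
qed

section \<open>Reduction to a missing edge inside \<open>A \<union> C\<close>\<close>

theorem theorem2p3:
  fixes G :: "'a pair_pre_digraph" and n \<delta> k :: nat
  assumes "pair_graph G" and "connected (with_proj G)"
    and "card (pverts G) = n" and "min_degree G = \<delta>"
    and "3 \<le> k" and "k \<le> \<delta>"
    and "iso_to_subgraph G (extremal_graph n \<delta> k)"
    and "real n \<ge> 1 / 2 * (real \<delta> - real k + 2) * (real k ^ 2 - 2 * real k + 7)"
    and "\<not> graph_iso G (extremal_graph n \<delta> k)"
  shows "graph_spectral_radius G < real n - real \<delta> + real k - 3"
proof -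
  interpret pair_graph G by fact
  let ?X = "extremal_graph n \<delta> k"
  define a b where "a = k - 1" and "b = \<delta> - k + 2"
  have ab: "real a = real k - 1" "real b = real \<delta> - real k + 2" "a + b = \<delta> + 1"
      "2 \<le> a" "2 \<le> b"
    using assms(5,6) by (auto simp: a_def b_def)
  \<comment> \<open>With \<open>a = k - 1\<close>, the factor \<open>k^2 - 2 * k + 7\<close> is
    \<open>a^2 + 6\<close>. Subtracting \<open>2 * b\<close> from both sides later yields the
    hypothesis on \<open>m = n - b\<close>.\<close>
  have n_ge: "real b * (real a ^ 2 + 6) \<le> 2 * real n"
    using assms(8) unfolding ab by (simp add: power2_eq_square algebra_simps)
  \<comment> \<open>Hence \<open>a + b \<le> n\<close>, that is \<open>\<delta> + 1 \<le> n\<close>,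
    so \<open>n - \<delta> - 1\<close> is not truncated.\<close>
  have "2 * real a + 2 * real b \<le> real b * (real a ^ 2 + 6)"
  proof -
    have "2 * real a \<le> real b * real a ^ 2"
      using ab(4,5) by (intro mult_mono self_le_power) auto
    then show ?thesis
      by (simp add: distrib_left)
  qed
  then have \<delta>_n: "\<delta> < n"
    using n_ge ab(3) by linarith
  have X: "pair_graph ?X"
    unfolding extremal_graph_def
    by (intro pair_graph_graph_join pair_graph_disjoint_union pair_graph_complete_graph)
  interpret X: pair_graph ?X by (rule X)
  obtain H where H: "subgraph (with_proj H) (with_proj ?X)" "graph_iso G H"
    using assms(7) unfolding iso_to_subgraph_def by blast
  from H(2) obtain f where f: "inj_on f (pverts G)" "pverts H = f ` pverts G"
      "parcs H = map_prod f f ` parcs G"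
    by (rule graph_isoE)
  have "pverts H \<subseteq> pverts ?X" and arcs: "map_prod f f ` parcs G \<subseteq> parcs ?X"
    using H(1) unfolding f(3)[symmetric] by (auto elim!: subgraphE)
  \<comment> \<open>Equal orders make \<open>H\<close> a spanning subgraph, so \<open>f\<close> is
    onto the vertices of \<open>?X\<close> and the three cliques pull back to a partition of
    \<open>pverts G\<close>.\<close>
  moreover have "card (pverts H) = card (pverts ?X)"
    using f(1,2) card_pverts_extremal_graph[of k \<delta> n] assms(3,5,6) \<delta>_n by (simp add: card_image)
  moreover have "finite (pverts ?X)"
    by (rule X.pair_finite_verts)
  ultimately have V: "pverts ?X = f ` pverts G"
    using f(2) card_subset_eq by metis
  have bij: "bij_betw f (pverts G) (pverts ?X)"
    using f(1) V by (simp add: bij_betw_def)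
  define A where "A = {x \<in> pverts G. f x \<in> Inl ` {..<a}}"
  define B where "B = {x \<in> pverts G. f x \<in> Inr ` Inl ` {..<b}}"
  define C where "C = {x \<in> pverts G. f x \<in> Inr ` Inr ` {..<n - \<delta> - 1}}"
  have X_verts: "pverts ?X = Inl ` {..<a} \<union> Inr ` Inl ` {..<b} \<union> Inr ` Inr ` {..<n - \<delta> - 1}"
    by (auto simp: extremal_graph_def graph_join_def disjoint_union_def complete_graph_def
        a_def b_def)
  have part: "pverts G = A \<union> B \<union> C"
    using V X_verts unfolding A_def B_def C_def by blast
  have disj: "A \<inter> B = {}" "A \<inter> C = {}" "B \<inter> C = {}"
    by (auto simp: A_def B_def C_def)
  have card_preimage: "card {x \<in> pverts G. f x \<in> T} = card T" if "T \<subseteq> pverts ?X" for T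
  proof -
    have "f ` {x \<in> pverts G. f x \<in> T} = T"
      using that V by auto
    moreover have "inj_on f {x \<in> pverts G. f x \<in> T}"
      using f(1) by (rule inj_on_subset) auto
    ultimately show ?thesis
      using card_image by metis
  qed
  have "card A = a" "card B = b" "card C = n - \<delta> - 1"
    unfolding A_def B_def C_def using X_verts
    by (subst card_preimage; force simp: card_image inj_on_def)+
  note cards = this
  have fin: "finite A" "finite B" "finite C"
    using pair_finite_verts part by simp_all
  have no_BC: "(x, y) \<notin> parcs G" if "x \<in> B" "y \<in> C" for x y
    using that arcs by (force simp: B_def C_def extremal_graph_def)
  \<comment> \<open>The possible neighbours of \<open>x\<close> number
    \<open>a + b - 1 = \<delta>\<close>, so the minimum degree forces all of them.\<close>
  have full_B: "(x, y) \<in> parcs G" if x: "x \<in> B" and y: "y \<in> A \<union> B" "x \<noteq> y" for x y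
  proof -
    have sub: "{z. (x, z) \<in> parcs G} \<subseteq> A \<union> B - {x}"
      using x no_BC part pair_graph_arcD(2,3)[OF assms(1), of x] by blast
    have "card (A \<union> B - {x}) = \<delta>"
      using x fin disj cards ab(3) by (simp add: card_Un_disjoint)
    also have "\<dots> \<le> card {z. (x, z) \<in> parcs G}"
      using min_degree_le_card_neighbours[OF assms(1), of x] x part assms(4) by simp
    finally have "{z. (x, z) \<in> parcs G} = A \<union> B - {x}"
      using sub fin by (intro card_seteq) auto
    then show ?thesis
      using y by blast
  qed
  \<comment> \<open>Otherwise \<open>A \<union> C\<close> is a clique and, with
    \<open>full_B\<close>, every arc of \<open>?X\<close> comes from \<open>G\<close>, making
    \<open>f\<close> an isomorphism onto \<open>?X\<close>.\<close>
  obtain u v where e: "u \<in> A \<union> C" "v \<in> A \<union> C" "u \<noteq> v" "(u, v) \<notin> parcs G"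
  proof (rule ccontr)
    assume "\<not> thesis"
    with that have full_AC: "(x, y) \<in> parcs G" if "x \<in> A \<union> C" "y \<in> A \<union> C" "x \<noteq> y" for x y
      using that by blast
    have "parcs ?X \<subseteq> map_prod f f ` parcs G"
    proof (rule subrelI)
      fix p r assume pr: "(p, r) \<in> parcs ?X"
      obtain x y where xy: "x \<in> pverts G" "y \<in> pverts G" "p = f x" "r = f y"
        using pair_graph_arcD(1,2)[OF X pr] V by blast
      have "x \<noteq> y"
        using pair_graph_arcD(3)[OF X pr] xy by blast
      have "\<not> (x \<in> B \<and> y \<in> C)" "\<not> (x \<in> C \<and> y \<in> B)"
        using pr xy(3,4) by (auto simp: B_def C_def extremal_graph_def)
      then have "(x, y) \<in> parcs G"
        using xy(1,2) part \<open>x \<noteq> y\<close> full_AC full_B[of x y] full_B[of y x]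
          pair_graph_arcD(4)[OF assms(1), of y x] by blast
      then show "(p, r) \<in> map_prod f f ` parcs G"
        using xy(3,4) by auto
    qed
    with arcs have "graph_iso G ?X"
      using graph_isoI[OF assms(1) f(1) V] by blast
    with assms(9) show False ..
  qed
  have m: "real (card (A \<union> C)) = real n - real b"
    using fin disj cards ab \<delta>_n by (simp add: card_Un_disjoint of_nat_diff)
  have "graph_spectral_radius G < real (card (A \<union> C)) - 1"
  proof (rule graph_spectral_radius_lt_of_missing_edge[OF assms(1) part disj(1,3) no_BC e])
    show "2 \<le> real (card B)"
      using cards ab(5) by simp
    show "real (card B) * ((real (card A))\<^sup>2 + 4) \<le> 2 * real (card (A \<union> C))"
      using n_ge m cards by (simp add: distrib_left)
  qed
  then show ?thesis
    using m ab(2) by simp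
qed

end
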